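(* Let $\alpha,\beta>-1$. We have $$\sum_{n=0}^\infty\frac{L_n^{(\alpha)}(x)L_n^{(\beta)}(y)}{(q;q)_n}t^n=\frac{1}{(t;q)_\infty}\sum_{n=0}^\infty\sum_{k=0}^\infty\frac{q^{(n+k)^2+(n+k)\beta+k(k+\alpha)}(xyt)^k(-yt)^n}{(q;q)_k(q;q)_n(q^{\alpha+1};q)_k(q^{\beta+1};q)_{n+k}}\;{}_0\phi_1\left(\begin{gathered}-\\ q^{\alpha+k+1}\end{gathered};\,q,\,-xtq^{\alpha+2k+n+1}\right).$$
   Context: Fix $q$ with $0<|q|<1$; real powers $q^{s}$ are taken with respect to a fixed choice of $\log q$. $(a;q)_0=1$, $(a;q)_n=\prod_{i=0}^{n-1}(1-aq^i)$, $(a;q)_\infty=\prod_{i\ge0}(1-aq^i)$, $\begin{bmatrix} n\\ k\end{bmatrix}=\frac{(q;q)_n}{(q;q)_k(q;q)_{n-k}}$. ${}_0\phi_1\left(\begin{gathered}-\\ b\end{gathered};q,z\right)=\sum_{n=0}^\infty\frac{q^{n(n-1)}z^n}{(b;q)_n(q;q)_n}$. The $q$-Laguerre polynomials are here normalized as $$L_n^{(\alpha)}(x)=\sum_{k=0}^n\begin{bmatrix} n\\ k\end{bmatrix}\frac{q^{k^2+k\alpha}}{(q^{\alpha+1};q)_k}(-x)^k .$$ *)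

theory Defs
  imports "HOL-Analysis.Analysis"
begin

text \<open>
  Real powers of a complex base \<open>q\<close> depend on the choice of a logarithm of \<open>q\<close>.  Notions that
  involve real powers therefore take that logarithm \<open>l\<close> as a parameter, with \<open>q = exp l\<close>; for
  integer \<open>s\<close> the value of \<open>qpower l s\<close> does not depend on the choice of \<open>l\<close>.
\<close>

definition qpower :: "complex \<Rightarrow> real \<Rightarrow> complex" where
  "qpower l s = exp (of_real s * l)"

definition qpoch :: "complex \<Rightarrow> complex \<Rightarrow> nat \<Rightarrow> complex" where
  "qpoch a q n = (\<Prod>i<n. 1 - a * q ^ i)"

definition qpoch_inf :: "complex \<Rightarrow> complex \<Rightarrow> complex" where
  "qpoch_inf a q = (\<Prod>i. 1 - a * q ^ i)"

definition qbinomial :: "complex \<Rightarrow> nat \<Rightarrow> nat \<Rightarrow> complex" where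
  "qbinomial q n k = qpoch q q n / (qpoch q q k * qpoch q q (n - k))"

definition phi01 :: "complex \<Rightarrow> complex \<Rightarrow> complex \<Rightarrow> complex" where
  "phi01 b q z = (\<Sum>n. q ^ (n * (n - 1)) * z ^ n / (qpoch b q n * qpoch q q n))"

text \<open>
  The normalization below differs from the usual one for the \<open>q\<close>-Laguerre polynomials by the
  factor \<open>(q\<^sup>\<alpha>\<^sup>+\<^sup>1;q)\<^sub>n / (q;q)\<^sub>n\<close>; here the value at \<open>x = 0\<close> is \<open>1\<close>.
\<close>

definition qlaguerre :: "complex \<Rightarrow> real \<Rightarrow> nat \<Rightarrow> complex \<Rightarrow> complex" where
  "qlaguerre l \<alpha> n x =
     (\<Sum>k\<le>n. qbinomial (exp l) n k * qpower l (real k ^ 2 + real k * \<alpha>)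
               / qpoch (qpower l (\<alpha> + 1)) (exp l) k * (- x) ^ k)"

end

theory Submission
  imports Defs
begin

text \<open>
  Expanding \<open>phi01\<close> and comparing coefficients of \<open>x\<^sup>j y\<^sup>m\<close>, the claim reduces to
  \<open>\<Sum>\<^sub>M [M,j] [M,m] t\<^sup>M / (q;q)\<^sub>M = 1/(t;q)\<^sub>\<infinity> \<Sum>\<^sub>k (\<dots>) t\<^bsup>j+m-k\<^esup>\<close>.  By Euler's expansion of
  \<open>1/(t;q)\<^sub>\<infinity>\<close>, the coefficient of \<open>t\<^sup>M\<close> in this identity is the \<open>q\<close>-Vandermonde convolution
  for \<open>[j + (M - j), m]\<close>.  All rearrangements are carried out in one absolutely convergent sum
  over \<open>(N, n, k, p)\<close>, where \<open>N\<close> comes from Euler's series and \<open>p\<close> from \<open>phi01\<close>, grouped by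
  \<open>M = N + n + k + p\<close>.
\<close>

section \<open>q-shifted factorials: splitting, nonvanishing and uniform bounds\<close>

lemma qpoch_0 [simp]: "qpoch a q 0 = 1"
  by (simp add: qpoch_def)

lemma qpoch_Suc: "qpoch a q (Suc n) = qpoch a q n * (1 - a * q ^ n)"
  by (simp add: qpoch_def)

lemma qpoch_add: "qpoch a q (m + n) = qpoch a q m * qpoch (a * q ^ m) q n"
  by (induction n) (simp_all add: qpoch_Suc power_add mult_ac)

lemma qpoch_factor_nonzero:
  fixes a q :: complex
  assumes "norm a < 1" "norm q < 1"
  shows "1 - a * q ^ i \<noteq> 0"
proof -
  have "norm (a * q ^ i) \<le> norm a * 1"
    unfolding norm_mult norm_power
    by (intro mult_left_mono power_le_one) (use assms in auto)
  then have "norm (a * q ^ i) < 1" using assms by simp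
  then show ?thesis by auto
qed

lemma qpoch_nonzero:
  assumes "norm a < 1" "norm q < 1"
  shows "qpoch a q n \<noteq> 0"
  unfolding qpoch_def using qpoch_factor_nonzero[OF assms] by simp

text \<open>The series of \<open>a * q ^ i\<close> is dominated by a geometric one, so the product
  converges absolutely; a convergent product without zero factors has a nonzero value.\<close>

lemma qpoch_LIMSEQ:
  assumes "norm a < 1" "norm q < 1"
  shows "qpoch a q \<longlonglongrightarrow> qpoch_inf a q" and "qpoch_inf a q \<noteq> 0"
proof -
  have "summable (\<lambda>i. norm ((1 - a * q ^ i) - 1))"
    using assms by (auto simp: norm_mult norm_power intro!: summable_mult summable_geometric)
  then have conv: "convergent_prod (\<lambda>i. 1 - a * q ^ i)"
    by (intro abs_convergent_prod_imp_convergent_prod summable_imp_abs_convergent_prod)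
  show "qpoch_inf a q \<noteq> 0"
    unfolding qpoch_inf_def by (rule prodinf_nonzero[OF conv qpoch_factor_nonzero[OF assms]])
  \<comment> \<open>Partial products of an infinite product run over \<open>i \<le> n\<close>, which
    is \<open>qpoch\<close> at \<open>Suc n\<close>; hence the shift by one.\<close>
  have "(\<lambda>n. qpoch a q (Suc n)) \<longlonglongrightarrow> qpoch_inf a q"
    using convergent_prod_LIMSEQ[OF conv] by (simp add: qpoch_def qpoch_inf_def lessThan_Suc_atMost)
  then show "qpoch a q \<longlonglongrightarrow> qpoch_inf a q"
    by (rule LIMSEQ_imp_Suc)
qed

text \<open>Since the limit of \<open>qpoch a q\<close> is nonzero, the reciprocals converge and so
  are bounded. This one constant handles every denominator in the convergence estimates.\<close>

lemma inverse_qpoch_bounded: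
  assumes "norm a < 1" "norm q < 1"
  obtains C where "C > 0" "\<And>n. norm (inverse (qpoch a q n)) \<le> C"
proof -
  have "(\<lambda>n. inverse (qpoch a q n)) \<longlonglongrightarrow> inverse (qpoch_inf a q)"
    by (intro tendsto_inverse qpoch_LIMSEQ assms)
  then have "Bseq (\<lambda>n. inverse (qpoch a q n))"
    by (rule convergent_imp_Bseq[OF convergentI])
  then show ?thesis using that by (auto simp: Bseq_def)
qed

section \<open>Euler's expansion of 1/(t;q)_infinity\<close>

lemma abs_summable_euler:
  assumes "norm q < 1" "norm t < 1"
  shows "summable (\<lambda>n. norm (t ^ n / qpoch q q n))"
proof -
  obtain C where C: "\<And>n. norm (inverse (qpoch q q n)) \<le> C"
    using inverse_qpoch_bounded[OF assms(1,1)] by metis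
  show ?thesis
  proof (rule summable_comparison_test')
    show "summable (\<lambda>n. C * norm t ^ n)"
      using assms by (intro summable_mult summable_geometric) auto
    show "norm (norm (t ^ n / qpoch q q n)) \<le> C * norm t ^ n" if "n \<ge> 0" for n
      using mult_right_mono[OF C[of n], of "norm t ^ n"]
      by (simp add: norm_divide norm_mult norm_power norm_inverse divide_inverse mult.commute)
  qed
qed

text \<open>
  With \<open>F t\<close> the series, comparing coefficients gives \<open>(1 - t) F t = F (q t)\<close>; iterate and use
  continuity of \<open>F\<close> at \<open>0\<close>.
\<close>
lemma euler_sums:
  assumes q: "norm q < 1" and t: "norm t < 1"
  shows "(\<lambda>n. t ^ n / qpoch q q n) sums (1 / qpoch_inf t q)"
proof -
  define F where "F = (\<lambda>z. \<Sum>n. z ^ n / qpoch q q n)"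
  have nz: "qpoch q q n \<noteq> 0" for n using qpoch_nonzero[OF q q] .
  have sumF: "(\<lambda>n. z ^ n / qpoch q q n) sums F z" if "norm z < 1" for z
    unfolding F_def using summable_norm_cancel[OF abs_summable_euler[OF q that]]
    by (rule summable_sums)
  have step: "(1 - z) * F z = F (z * q)" if z: "norm z < 1" for z
  proof -
    have zq: "norm (z * q) < 1"
      using mult_strict_mono'[OF z q] by (simp add: norm_mult)
    \<comment> \<open>\<open>g\<close> is the series of \<open>z * F z\<close> moved up one index,
      with 0 in front, so that it can be subtracted termwise from the series of
      \<open>F z\<close>.\<close>
    define g where "g = (\<lambda>n. case n of 0 \<Rightarrow> 0 | Suc m \<Rightarrow> z * (z ^ m / qpoch q q m))"
    have "(\<lambda>n. g (Suc n)) sums (z * F z)"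
      unfolding g_def using sums_mult[OF sumF[OF z], of z] by simp
    then have "g sums (z * F z)"
      by (subst (asm) sums_Suc_iff) (simp add: g_def)
    then have "(\<lambda>n. z ^ n / qpoch q q n - g n) sums (F z - z * F z)"
      by (intro sums_diff sumF z)
    \<comment> \<open>For \<open>n > 0\<close> the difference is z^n (1 - (1 - q^n)) /
      (q;q)_n.\<close>
    moreover have "z ^ n / qpoch q q n - g n = (z * q) ^ n / qpoch q q n" for n
    proof (cases n)
      case (Suc m)
      have "1 - q * q ^ m \<noteq> 0" using qpoch_factor_nonzero[OF q q] .
      then show ?thesis using nz[of m]
        by (simp add: Suc g_def qpoch_Suc divide_simps power_mult_distrib) (simp add: algebra_simps)
    qed (simp add: g_def)
    ultimately show ?thesis using sums_unique2[OF _ sumF[OF zq]] by (simp add: algebra_simps)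
  qed
  have small: "norm (t * q ^ n) < 1" for n
  proof -
    have "norm (t * q ^ n) \<le> norm t * 1"
      unfolding norm_mult norm_power by (intro mult_left_mono power_le_one) (use q in auto)
    then show ?thesis using t by simp
  qed
  have iter: "qpoch t q n * F t = F (t * q ^ n)" for n
  proof (induction n)
    case (Suc n)
    have "qpoch t q (Suc n) * F t = (1 - t * q ^ n) * (qpoch t q n * F t)"
      by (simp add: qpoch_Suc mult_ac)
    also have "\<dots> = F (t * q ^ Suc n)"
      using Suc step[OF small[of n]] by (simp add: mult_ac)
    finally show ?case .
  qed simp
  have F: "F = (\<lambda>z. \<Sum>n. inverse (qpoch q q n) * z ^ n)"
    unfolding F_def divide_inverse_commute ..
  have "isCont F 0"
  proof -
    have summable: "summable (\<lambda>n. inverse (qpoch q q n) * z ^ n)" if "norm z < 1" for z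
      using sums_summable[OF sumF[OF that]] unfolding divide_inverse_commute .
    \<comment> \<open>Convergence at 1/2, one nonzero point of the unit disc, already gives
      continuity at 0.\<close>
    show ?thesis
      unfolding F by (rule isCont_powser[OF summable[of "of_real (1/2)"]]) auto
  qed
  moreover have "(\<lambda>n. t * q ^ n) \<longlonglongrightarrow> 0"
    using tendsto_mult[OF tendsto_const LIMSEQ_power_zero[OF q], of t] by simp
  ultimately have "(\<lambda>n. F (t * q ^ n)) \<longlonglongrightarrow> F 0"
    using isCont_tendsto_compose by blast
  moreover have "F 0 = 1"
    unfolding F by (simp add: powser_zero)
  moreover have "(\<lambda>n. F (t * q ^ n)) \<longlonglongrightarrow> qpoch_inf t q * F t"
    unfolding iter[symmetric] by (intro tendsto_mult qpoch_LIMSEQ tendsto_const t q)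
  ultimately have "qpoch_inf t q * F t = 1"
    using LIMSEQ_unique by metis
  then have "F t = 1 / qpoch_inf t q"
    using qpoch_LIMSEQ(2)[OF t q] by (simp add: field_simps)
  then show ?thesis using sumF[OF t] by simp
qed

section \<open>Gaussian binomials and the q-Vandermonde convolution\<close>

text \<open>
  \<^term>\<open>qbinomial q n k\<close> is a junk value for \<open>k > n\<close>; the version extended by zero satisfies both
  Pascal recurrences without side conditions.
\<close>
definition qbinom0 :: "complex \<Rightarrow> nat \<Rightarrow> nat \<Rightarrow> complex" where
  "qbinom0 q n k = (if k \<le> n then qbinomial q n k else 0)"

lemma qbinom0_0_right [simp]: "norm q < 1 \<Longrightarrow> qbinom0 q n 0 = 1"
  using qpoch_nonzero[of q q n] by (simp add: qbinom0_def qbinomial_def)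

text \<open>In the interior case, with n = k + d + 1, clearing denominators leaves 1 - q^(n+1) =
  q^(k+1) (1 - q^(d+1)) + (1 - q^(k+1)). The boundary \<open>k = n\<close> is separate because there
  \<open>qbinom0 q n (Suc k)\<close> is 0 by convention.\<close>

lemma qbinom0_pascal:
  assumes q: "norm q < 1"
  shows "qbinom0 q (Suc n) (Suc k) = q ^ Suc k * qbinom0 q n (Suc k) + qbinom0 q n k"
proof -
  consider "k > n" | "k = n" | "k < n" by linarith
  then show ?thesis
  proof cases
    case 2
    then show ?thesis using qpoch_nonzero[OF q q] by (simp add: qbinom0_def qbinomial_def)
  next
    case 3
    then obtain d where d: "n = Suc (k + d)" using less_iff_Suc_add by auto
    have nz: "qpoch q q i \<noteq> 0" "1 - q * q ^ i \<noteq> 0" for i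
      using qpoch_nonzero[OF q q] qpoch_factor_nonzero[OF q q] by auto
    have e: "Suc n - Suc k = Suc d" "n - Suc k = d" "n - k = Suc d" using d by auto
    have "qpoch q q (Suc n) / (qpoch q q (Suc k) * qpoch q q (Suc d)) =
        q ^ Suc k * (qpoch q q n / (qpoch q q (Suc k) * qpoch q q d))
          + qpoch q q n / (qpoch q q k * qpoch q q (Suc d))"
      using nz[of k] nz[of d] by (simp add: qpoch_Suc[of _ _ k] qpoch_Suc[of _ _ d]
        qpoch_Suc[of _ _ n] divide_simps) (simp add: d power_add algebra_simps)
    then show ?thesis using d by (simp add: qbinom0_def qbinomial_def e)
  qed (simp add: qbinom0_def)
qed

text \<open>Induction on \<open>j\<close>: Pascal's rule inside the sum splits it into
  \<open>q ^ m * qbinom0 q (j + r) m\<close> and \<open>qbinom0 q (j + r) (m - 1)\<close>, which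
  Pascal's rule recombines. Truncation in \<open>j - k\<close> is harmless, since
  \<open>qbinom0 q j k\<close> is 0 for \<open>k > j\<close>.\<close>

lemma q_vandermonde:
  assumes q: "norm q < 1"
  shows "qbinom0 q (j + r) m =
    (\<Sum>k\<le>m. q ^ ((m - k) * (j - k)) * qbinom0 q j k * qbinom0 q r (m - k))"
proof (induction j arbitrary: m)
  case 0
  have "(\<Sum>k\<le>m. q ^ ((m - k) * (0 - k)) * qbinom0 q 0 k * qbinom0 q r (m - k)) =
      (\<Sum>k\<in>{0}. q ^ ((m - k) * (0 - k)) * qbinom0 q 0 k * qbinom0 q r (m - k))"
    by (intro sum.mono_neutral_right) (auto simp: qbinom0_def)
  then show ?case using q by simp
next
  case (Suc j)
  show ?case
  proof (cases m)
    case 0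
    then show ?thesis using q by simp
  next
    case (Suc m')
    \<comment> \<open>For \<open>k \<le> j\<close> the exponents agree: (m-k)(j+1-k) + k = m +
      (m-k)(j-k). For \<open>k > j\<close> both sides are 0.\<close>
    have A: "q ^ ((m - k) * (Suc j - k)) * (q ^ k * qbinom0 q j k) =
        q ^ m * (q ^ ((m - k) * (j - k)) * qbinom0 q j k)" if "k \<le> m" for k
    proof (cases "k \<le> j")
      case True
      then have "(m - k) * (Suc j - k) + k = m + (m - k) * (j - k)"
        using that by (simp add: Suc_diff_le)
      then show ?thesis by (simp add: mult.assoc[symmetric] power_add[symmetric])
    qed (simp add: qbinom0_def)
    \<comment> \<open>The term \<open>k = 0\<close> is split off so that Pascal's rule applies to
      all the others; it is put back once the two summands are separated.\<close>
    have "(\<Sum>k\<le>m. q ^ ((m - k) * (Suc j - k)) * qbinom0 q (Suc j) k * qbinom0 q r (m - k)) =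
        q ^ (m * Suc j) * qbinom0 q r m
        + (\<Sum>k\<le>m'. q ^ ((m' - k) * (j - k)) *
            (q ^ Suc k * qbinom0 q j (Suc k) + qbinom0 q j k) * qbinom0 q r (m' - k))"
      unfolding Suc by (subst sum.atMost_Suc_shift) (simp add: qbinom0_pascal[OF q] q del: power_Suc)
    also have "\<dots> = (q ^ (m * Suc j) * qbinom0 q r m
        + (\<Sum>k\<le>m'. q ^ ((m - Suc k) * (Suc j - Suc k)) *
            (q ^ Suc k * qbinom0 q j (Suc k)) * qbinom0 q r (m - Suc k)))
        + (\<Sum>k\<le>m'. q ^ ((m' - k) * (j - k)) * qbinom0 q j k * qbinom0 q r (m' - k))"
      by (simp add: Suc sum.distrib[symmetric] algebra_simps)
    also have "q ^ (m * Suc j) * qbinom0 q r m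
        + (\<Sum>k\<le>m'. q ^ ((m - Suc k) * (Suc j - Suc k)) *
            (q ^ Suc k * qbinom0 q j (Suc k)) * qbinom0 q r (m - Suc k)) =
        (\<Sum>k\<le>m. q ^ ((m - k) * (Suc j - k)) * (q ^ k * qbinom0 q j k) * qbinom0 q r (m - k))"
      unfolding Suc by (subst sum.atMost_Suc_shift[of _ m']) (simp add: q)
    also have "\<dots> = q ^ m * (\<Sum>k\<le>m. q ^ ((m - k) * (j - k)) * qbinom0 q j k * qbinom0 q r (m - k))"
      unfolding sum_distrib_left
    proof (rule sum.cong)
      fix k assume "k \<in> {..m}"
      then show "q ^ ((m - k) * (Suc j - k)) * (q ^ k * qbinom0 q j k) * qbinom0 q r (m - k) =
          q ^ m * (q ^ ((m - k) * (j - k)) * qbinom0 q j k * qbinom0 q r (m - k))"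
        using A[of k] by (simp add: mult.assoc[symmetric])
    qed simp
    also have "\<dots> = q ^ m * qbinom0 q (j + r) m" using Suc.IH by simp
    also have "(\<Sum>k\<le>m'. q ^ ((m' - k) * (j - k)) * qbinom0 q j k * qbinom0 q r (m' - k))
        = qbinom0 q (j + r) m'" using Suc.IH by simp
    finally show ?thesis using qbinom0_pascal[OF q, of "j + r" m'] by (simp add: Suc)
  qed
qed

text \<open>Vandermonde is applied to the second factor with \<open>M = j + (M - j)\<close>. The
  first factor divided by (q;q)_M is 1/((q;q)_j (q;q)_(M-j)), which cancels the numerators of the
  convolution.\<close>

lemma qbinomial_mult:
  assumes q: "norm q < 1" and j: "j \<le> M" and m: "m \<le> M"
  shows "qbinomial q M j * qbinomial q M m / qpoch q q M =
    (\<Sum>k | k \<le> j \<and> k \<le> m \<and> j + m \<le> M + k.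
       q ^ ((m - k) * (j - k)) /
         (qpoch q q k * qpoch q q (m - k) * qpoch q q (j - k) * qpoch q q (M + k - (j + m))))"
    (is "_ = sum ?f ?K")
proof -
  have nz: "qpoch q q i \<noteq> 0" for i using qpoch_nonzero[OF q q] .
  have "qbinomial q M m = qbinom0 q (j + (M - j)) m" using j m by (simp add: qbinom0_def)
  also have "\<dots> = (\<Sum>k\<le>m. q ^ ((m - k) * (j - k)) * qbinom0 q j k * qbinom0 q (M - j) (m - k))"
    by (rule q_vandermonde[OF q])
  \<comment> \<open>Outside \<open>?K\<close> either \<open>k > j\<close> or
    \<open>m - k > M - j\<close>, and one of the extended binomials vanishes.\<close>
  also have "\<dots> = (\<Sum>k\<in>?K. q ^ ((m - k) * (j - k)) * qbinom0 q j k * qbinom0 q (M - j) (m - k))"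
    by (rule sum.mono_neutral_right) (use j in \<open>auto simp: qbinom0_def\<close>)
  also have "\<dots> = (\<Sum>k\<in>?K. qpoch q q j * qpoch q q (M - j) * ?f k)"
  proof (rule sum.cong)
    fix k assume k: "k \<in> ?K"
    then have "M - j - (m - k) = M + k - (j + m)" "k \<le> j" "m - k \<le> M - j" using j by auto
    then show "q ^ ((m - k) * (j - k)) * qbinom0 q j k * qbinom0 q (M - j) (m - k) =
        qpoch q q j * qpoch q q (M - j) * ?f k"
      using nz by (simp add: qbinom0_def qbinomial_def mult_ac)
  qed simp
  finally have "qbinomial q M m = qpoch q q j * qpoch q q (M - j) * sum ?f ?K"
    by (simp add: sum_distrib_left)
  moreover have "qbinomial q M j = qpoch q q M / (qpoch q q j * qpoch q q (M - j))"
    by (simp add: qbinomial_def)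
  ultimately show ?thesis using nz by simp
qed

section \<open>Real powers of q and Gaussian decay\<close>

lemma norm_qpower: "norm (qpower l s) = exp (s * Re l)"
  by (simp add: qpower_def)

lemma qpower_add: "qpower l (s + r) = qpower l s * qpower l r"
  by (simp add: qpower_def exp_add algebra_simps)

lemma qpower_of_nat: "qpower l (real n) = exp l ^ n"
  by (simp add: qpower_def exp_of_nat_mult)

lemma qpower_power: "qpower l s ^ n = qpower l (real n * s)"
  by (simp add: qpower_def exp_of_nat_mult[symmetric] mult.assoc)

text \<open>The Gaussian factor beats every geometric one, so that the terms decay at least like \<open>2\<^sup>-\<^sup>j\<close>.\<close>
lemma qpower_quadratic_bound:
  assumes "Re l < 0"
  obtains C where "C > 0" "\<And>j. norm (qpower l (real j ^ 2 + real j * \<alpha>) * x ^ j) \<le> C * (1/2) ^ j"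
proof -
  \<comment> \<open>As j^2 + j \<alpha> = j (j + \<alpha>), the norm of the j-th term times 2^j is
    the j-th power of this base; it is at most 1 once the base is below 1.\<close>
  have "(\<lambda>j. exp ((real j + \<alpha>) * Re l) * (2 * norm x)) \<longlonglongrightarrow> 0"
  proof -
    have "filterlim (\<lambda>j. real j + \<alpha>) at_top sequentially"
      using filterlim_tendsto_add_at_top[OF tendsto_const filterlim_real_sequentially, of \<alpha>]
      by (simp add: add.commute)
    then have "filterlim (\<lambda>j. (real j + \<alpha>) * Re l) at_bot sequentially"
      using assms by (subst mult.commute) (rule filterlim_tendsto_neg_mult_at_bot[OF tendsto_const])
    then have "(\<lambda>j. exp ((real j + \<alpha>) * Re l)) \<longlonglongrightarrow> 0"
      by (rule filterlim_compose[OF exp_at_bot])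
    then show ?thesis using tendsto_mult_left_zero by blast
  qed
  then have "\<forall>\<^sub>F j in sequentially. exp ((real j + \<alpha>) * Re l) * (2 * norm x) < 1"
    by (rule order_tendstoD) simp
  then have ev: "\<forall>\<^sub>F j in sequentially.
      norm (qpower l (real j ^ 2 + real j * \<alpha>) * x ^ j * 2 ^ j) \<le> norm (1::real)"
  proof eventually_elim
    case (elim j)
    have "norm (qpower l (real j ^ 2 + real j * \<alpha>) * x ^ j * 2 ^ j) =
        (exp ((real j + \<alpha>) * Re l) * (2 * norm x)) ^ j"
      by (simp add: norm_mult norm_power norm_qpower power_mult_distrib exp_of_nat_mult[symmetric]
          power2_eq_square algebra_simps)
    also have "\<dots> \<le> 1" using elim by (intro power_le_one) auto
    finally show ?case by simp
  qed
  have "Bseq (\<lambda>j. qpower l (real j ^ 2 + real j * \<alpha>) * x ^ j * 2 ^ j)"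
    by (rule Bseq_eventually_mono[OF ev]) simp
  then obtain C where C: "C > 0"
    "\<And>j. norm (qpower l (real j ^ 2 + real j * \<alpha>) * x ^ j * 2 ^ j) \<le> C"
    by (auto simp: Bseq_def)
  have "norm (qpower l (real j ^ 2 + real j * \<alpha>) * x ^ j) \<le> C * (1/2) ^ j" for j
    using C(2)[of j] by (simp add: norm_mult norm_power field_simps)
  with C(1) show ?thesis using that by blast
qed

section \<open>Products of absolutely summable families\<close>

lemma norm_summable_on_Times:
  fixes f :: "'a \<Rightarrow> 'c :: {real_normed_field, banach}" and g :: "'b \<Rightarrow> 'c"
  assumes "(\<lambda>x. norm (f x)) summable_on A" "(\<lambda>y. norm (g y)) summable_on B"
  shows "(\<lambda>(x, y). norm (f x * g y)) summable_on A \<times> B"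
proof (rule summable_on_SigmaI)
  show "((\<lambda>y. case (x, y) of (x, y) \<Rightarrow> norm (f x * g y)) has_sum
      norm (f x) * infsum (\<lambda>y. norm (g y)) B) B" for x
    using has_sum_cmult_right[OF has_sum_infsum[OF assms(2)]] by (simp add: norm_mult)
  show "(\<lambda>x. norm (f x) * infsum (\<lambda>y. norm (g y)) B) summable_on A"
    by (intro summable_on_cmult_left assms)
qed simp

text \<open>The norms give summability over the product set; summing first over \<open>B\<close> and
  then over \<open>A\<close> identifies the value.\<close>

lemma has_sum_Times:
  fixes f :: "'a \<Rightarrow> 'c :: {real_normed_field, banach}" and g :: "'b \<Rightarrow> 'c"
  assumes f: "(\<lambda>x. norm (f x)) summable_on A" "(f has_sum a) A"
    and g: "(\<lambda>y. norm (g y)) summable_on B" "(g has_sum b) B"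
  shows "((\<lambda>(x, y). f x * g y) has_sum a * b) (A \<times> B)"
proof -
  let ?h = "\<lambda>(x, y). f x * g y"
  have "(\<lambda>z. norm (?h z)) summable_on A \<times> B"
    using norm_summable_on_Times[OF f(1) g(1)] by (simp add: case_prod_unfold)
  then have S: "(?h has_sum infsum ?h (A \<times> B)) (A \<times> B)"
    by (rule has_sum_infsum[OF abs_summable_summable])
  have "((\<lambda>x. f x * b) has_sum infsum ?h (A \<times> B)) A"
    by (rule has_sum_SigmaD[OF S]) (simp add: has_sum_cmult_right g)
  moreover have "((\<lambda>x. f x * b) has_sum a * b) A"
    by (rule has_sum_cmult_left[OF f(2)])
  ultimately show ?thesis using S has_sum_unique by metis
qed

section \<open>Coefficients of the q-Laguerre polynomials and the expanded right-hand side\<close>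

text \<open>The summand of \<open>qlaguerre\<close> without its q-binomial, hence independent of the
  degree.\<close>

definition qlag_coeff :: "complex \<Rightarrow> real \<Rightarrow> complex \<Rightarrow> nat \<Rightarrow> complex" where
  "qlag_coeff l \<alpha> x k =
     qpower l (real k ^ 2 + real k * \<alpha>) / qpoch (qpower l (\<alpha> + 1)) (exp l) k * (- x) ^ k"

lemma qlaguerre_eq: "qlaguerre l \<alpha> n x = (\<Sum>k\<le>n. qbinomial (exp l) n k * qlag_coeff l \<alpha> x k)"
  by (simp add: qlaguerre_def qlag_coeff_def mult.assoc)

lemma norm_qpower_less_1:
  assumes "Re l < 0" "s > 0"
  shows "norm (qpower l s) < 1"
  using assms by (simp add: norm_qpower mult_pos_neg)

text \<open>\<open>\<alpha> > -1\<close> puts q^(\<alpha>+1) inside the unit disc, so the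
  denominators are bounded away from 0 and the Gaussian decay survives.\<close>

lemma qlag_coeff_bound:
  assumes l: "Re l < 0" and \<alpha>: "\<alpha> > -1"
  obtains C where "C > 0" "\<And>k. norm (qlag_coeff l \<alpha> x k) \<le> C * (1/2) ^ k"
proof -
  obtain C where C: "C > 0"
    "\<And>j. norm (qpower l (real j ^ 2 + real j * \<alpha>) * (- x) ^ j) \<le> C * (1/2) ^ j"
    using qpower_quadratic_bound[OF l] by metis
  have "norm (qpower l (\<alpha> + 1)) < 1" "norm (exp l) < 1"
    using norm_qpower_less_1[OF l, of "\<alpha> + 1"] \<alpha> l by auto
  then obtain D where D: "D > 0" "\<And>n. norm (inverse (qpoch (qpower l (\<alpha> + 1)) (exp l) n)) \<le> D"
    using inverse_qpoch_bounded by metis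
  have "norm (qlag_coeff l \<alpha> x k) \<le> D * C * (1/2) ^ k" for k
  proof -
    have "norm (qlag_coeff l \<alpha> x k) = norm (inverse (qpoch (qpower l (\<alpha> + 1)) (exp l) k)) *
        norm (qpower l (real k ^ 2 + real k * \<alpha>) * (- x) ^ k)"
      by (simp add: qlag_coeff_def norm_mult norm_divide norm_inverse divide_inverse)
    also have "\<dots> \<le> D * (C * (1/2) ^ k)"
      using C D by (intro mult_mono) auto
    finally show ?thesis by simp
  qed
  then show ?thesis using that[of "D * C"] C D by simp
qed

text \<open>
  The terms of the right-hand side with \<open>phi01\<close> expanded; \<open>k + p\<close> and \<open>n + k\<close> are the
  exponents of \<open>x\<close> and \<open>y\<close>.
\<close>
definition triple_term ::
  "complex \<Rightarrow> real \<Rightarrow> real \<Rightarrow> complex \<Rightarrow> complex \<Rightarrow> complex \<Rightarrow> nat \<times> nat \<times> nat \<Rightarrow> complex" where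
  "triple_term l \<alpha> \<beta> x y t = (\<lambda>(n, k, p).
     exp l ^ (n * p) * qlag_coeff l \<alpha> x (k + p) * qlag_coeff l \<beta> y (n + k) * t ^ (n + k + p)
       / (qpoch (exp l) (exp l) k * qpoch (exp l) (exp l) n * qpoch (exp l) (exp l) p))"

text \<open>The coefficient bounds supply (1/2)^(k+p) and (1/2)^(n+k), so a product of three
  geometric series dominates; the surplus (1/2)^k is discarded. Powers of q and t are at most 1 in
  norm.\<close>

lemma triple_term_abs_summable:
  assumes l: "Re l < 0" and \<alpha>: "\<alpha> > -1" and \<beta>: "\<beta> > -1" and t: "norm t < 1"
  shows "(\<lambda>z. norm (triple_term l \<alpha> \<beta> x y t z)) summable_on UNIV"
proof -
  obtain A where A: "A > 0" "\<And>k. norm (qlag_coeff l \<alpha> x k) \<le> A * (1/2) ^ k"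
    using qlag_coeff_bound[OF l \<alpha>] by metis
  obtain B where B: "B > 0" "\<And>k. norm (qlag_coeff l \<beta> y k) \<le> B * (1/2) ^ k"
    using qlag_coeff_bound[OF l \<beta>] by metis
  have q: "norm (exp l) < 1" using l by simp
  obtain D where D: "D > 0" "\<And>n. norm (inverse (qpoch (exp l) (exp l) n)) \<le> D"
    using inverse_qpoch_bounded[OF q q] by metis
  define h :: "nat \<Rightarrow> real" where "h = (\<lambda>n. (1/2) ^ n)"
  have h: "(\<lambda>n. norm (h n)) summable_on UNIV"
    by (intro norm_summable_imp_summable_on) (simp add: h_def)
  have h3: "(\<lambda>(n, z). norm (h n * (case z of (k, p) \<Rightarrow> h k * h p))) summable_on UNIV"
    using norm_summable_on_Times[OF h, of "\<lambda>z. case z of (k, p) \<Rightarrow> h k * h p" UNIV]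
      norm_summable_on_Times[OF h h] by (simp add: case_prod_unfold)
  show ?thesis
  proof (rule Infinite_Sum.abs_summable_on_comparison_test'[OF summable_on_cmult_right[OF h3, of "A * B * D ^ 3"]])
    fix z :: "nat \<times> nat \<times> nat"
    obtain n k p where z: "z = (n, k, p)" by (cases z) auto
    let ?Q = "\<lambda>n. norm (inverse (qpoch (exp l) (exp l) n))"
    have "norm (triple_term l \<alpha> \<beta> x y t z) = norm (exp l) ^ (n * p) * norm t ^ (n + k + p) *
        (norm (qlag_coeff l \<alpha> x (k + p)) * norm (qlag_coeff l \<beta> y (n + k)) * (?Q k * ?Q n * ?Q p))"
      by (simp add: z triple_term_def norm_mult norm_divide norm_power norm_inverse divide_inverse
          mult_ac del: norm_exp_eq_Re)
    also have "\<dots> \<le> (1 * 1) * ((A * (1/2) ^ (k + p)) * (B * (1/2) ^ (n + k)) * (D * D * D))"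
    proof (intro mult_mono A(2) B(2) D(2))
      show "norm (exp l) ^ (n * p) \<le> 1" "norm t ^ (n + k + p) \<le> 1"
        using q t by (auto intro!: power_le_one simp del: norm_exp_eq_Re)
    qed (use A(1) B(1) D(1) in auto)
    also have "\<dots> = A * B * D ^ 3 * (h n * (h k * h p)) * (1/2) ^ k"
      by (simp add: h_def power_add power3_eq_cube)
    also have "\<dots> \<le> A * B * D ^ 3 * (h n * (h k * h p)) * 1"
      using A B D by (intro mult_left_mono power_le_one) (auto simp: h_def)
    finally show "norm (triple_term l \<alpha> \<beta> x y t z) \<le>
        A * B * D ^ 3 * (case z of (n, z) \<Rightarrow> norm (h n * (case z of (k, p) \<Rightarrow> h k * h p)))"
      by (simp add: z h_def)
  qed
qed

text \<open>Three matchings: \<open>E\<close> for the exponents of q, by expanding (k+p)^2;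
  \<open>P\<close> for splitting the \<alpha>-denominator at index \<open>k\<close>;
  \<open>X\<close> for the signs and powers of x, y, t.\<close>

lemma triple_term_eq:
  assumes "exp l = q"
  shows "triple_term l \<alpha> \<beta> x y t (n, k, p) =
    qpower l (real (n + k) ^ 2 + real (n + k) * \<beta> + real k * (real k + \<alpha>))
        * (x * y * t) ^ k * (- y * t) ^ n
        / (qpoch q q k * qpoch q q n * qpoch (qpower l (\<alpha> + 1)) q k
             * qpoch (qpower l (\<beta> + 1)) q (n + k))
     * (q ^ (p * (p - 1)) * (- x * t * qpower l (\<alpha> + 2 * real k + real n + 1)) ^ p /
         (qpoch (qpower l (\<alpha> + real k + 1)) q p * qpoch q q p))"
proof -
  \<comment> \<open>At \<open>p = 0\<close> the natural \<open>p - 1\<close> truncates, but the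
    factor \<open>p\<close> makes both sides 0.\<close>
  have "real (p * (p - 1)) = real p * (real p - 1)"
    by (cases p) (auto simp: algebra_simps)
  then have gauss: "q ^ (p * (p - 1)) = qpower l (real p * (real p - 1))"
    using qpower_of_nat[of l "p * (p - 1)"] assms by metis
  have E: "q ^ (n * p) * qpower l (real (k + p) ^ 2 + real (k + p) * \<alpha>)
        * qpower l (real (n + k) ^ 2 + real (n + k) * \<beta>) =
      qpower l (real (n + k) ^ 2 + real (n + k) * \<beta> + real k * (real k + \<alpha>))
        * q ^ (p * (p - 1)) * qpower l (\<alpha> + 2 * real k + real n + 1) ^ p"
    unfolding gauss qpower_power assms[symmetric] qpower_of_nat[symmetric] qpower_add[symmetric]
    by (rule arg_cong[where f = "qpower l"]) (simp add: power2_eq_square algebra_simps)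
  have P: "qpoch (qpower l (\<alpha> + 1)) q (k + p) =
      qpoch (qpower l (\<alpha> + 1)) q k * qpoch (qpower l (\<alpha> + real k + 1)) q p"
    using qpower_add[of l "\<alpha> + 1" "real k"]
    by (simp add: qpoch_add assms[symmetric] qpower_of_nat[symmetric] add_ac)
  have X: "(- x) ^ (k + p) * (- y) ^ (n + k) * t ^ (n + k + p) =
      (x * y * t) ^ k * (- y * t) ^ n * (- x * t) ^ p"
  proof -
    have "(- x) ^ (k + p) * (- y) ^ (n + k) * t ^ (n + k + p) =
        ((- x) * (- y) * t) ^ k * (- y * t) ^ n * (- x * t) ^ p"
      by (simp only: power_add power_mult_distrib mult_ac)
    then show ?thesis by simp
  qed
  have "triple_term l \<alpha> \<beta> x y t (n, k, p) =
     (q ^ (n * p) * qpower l (real (k + p) ^ 2 + real (k + p) * \<alpha>)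
        * qpower l (real (n + k) ^ 2 + real (n + k) * \<beta>))
     * ((- x) ^ (k + p) * (- y) ^ (n + k) * t ^ (n + k + p))
     / (qpoch (qpower l (\<alpha> + 1)) q (k + p) * qpoch (qpower l (\<beta> + 1)) q (n + k) *
        qpoch q q k * qpoch q q n * qpoch q q p)"
    by (simp add: triple_term_def qlag_coeff_def assms mult_ac)
  also have "\<dots> = (qpower l (real (n + k) ^ 2 + real (n + k) * \<beta> + real k * (real k + \<alpha>))
        * q ^ (p * (p - 1)) * qpower l (\<alpha> + 2 * real k + real n + 1) ^ p)
     * ((x * y * t) ^ k * (- y * t) ^ n * (- x * t) ^ p)
     / (qpoch (qpower l (\<alpha> + 1)) q k * qpoch (qpower l (\<alpha> + real k + 1)) q p
        * qpoch (qpower l (\<beta> + 1)) q (n + k) * qpoch q q k * qpoch q q n * qpoch q q p)"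
    by (simp only: E X P)
  finally show ?thesis
    unfolding power_mult_distrib[of "- x * t"] by (simp only: times_divide_times_eq mult_ac)
qed

text \<open>The Vandermonde index \<open>k\<close> is the overlap of the exponents j of x and m of
  y. With n = m - k and p = j - k, the condition \<open>j + m \<le> M + k\<close> becomes
  \<open>n + k + p \<le> M\<close>, and the slack \<open>M - (n + k + p)\<close> is the index in
  Euler's series.\<close>

lemma qlaguerre_mult:
  assumes q: "norm (exp l) < 1"
  shows "qlaguerre l \<alpha> M x * qlaguerre l \<beta> M y / qpoch (exp l) (exp l) M * t ^ M =
    (\<Sum>(n, k, p)\<in>{(n, k, p). n + k + p \<le> M}.
       t ^ (M - (n + k + p)) / qpoch (exp l) (exp l) (M - (n + k + p))
         * triple_term l \<alpha> \<beta> x y t (n, k, p))"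
proof -
  let ?q = "exp l" and ?A = "qlag_coeff l \<alpha> x" and ?B = "qlag_coeff l \<beta> y"
  let ?Q = "qpoch ?q ?q"
  define K where "K = (\<lambda>(j, m). {k. k \<le> j \<and> k \<le> m \<and> j + m \<le> M + k})"
  define f where "f = (\<lambda>((j, m), k). ?A j * ?B m * t ^ M *
    (?q ^ ((m - k) * (j - k)) / (?Q k * ?Q (m - k) * ?Q (j - k) * ?Q (M + k - (j + m)))))"
  have fin: "finite (K z)" for z
    by (cases z) (auto simp: K_def intro: finite_subset[of _ "{..fst z}"])
  have "qlaguerre l \<alpha> M x * qlaguerre l \<beta> M y / ?Q M * t ^ M =
      (\<Sum>j\<le>M. \<Sum>m\<le>M. ?A j * ?B m * t ^ M * (qbinomial ?q M j * qbinomial ?q M m / ?Q M))"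
    unfolding qlaguerre_eq sum_product unfolding sum_distrib_right sum_divide_distrib
    by (intro sum.cong refl) (simp add: mult_ac)
  also have "\<dots> = (\<Sum>j\<le>M. \<Sum>m\<le>M. \<Sum>k\<in>K (j, m). f ((j, m), k))"
    by (intro sum.cong refl) (simp add: qbinomial_mult[OF q] K_def f_def sum_distrib_left)
  also have "\<dots> = (\<Sum>z\<in>{..M} \<times> {..M}. \<Sum>k\<in>K z. f (z, k))"
    by (simp add: sum.cartesian_product case_prod_unfold)
  also have "\<dots> = (\<Sum>z\<in>Sigma ({..M} \<times> {..M}) K. f z)"
    using fin by (subst sum.Sigma) auto
  also have "\<dots> = (\<Sum>(n, k, p)\<in>{(n, k, p). n + k + p \<le> M}.
       t ^ (M - (n + k + p)) / ?Q (M - (n + k + p)) * triple_term l \<alpha> \<beta> x y t (n, k, p))"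
  proof (rule sum.reindex_bij_witness[of _ "\<lambda>(n, k, p). ((k + p, n + k), k)"
        "\<lambda>((j, m), k). (m - k, k, j - k)"])
    fix z assume "z \<in> Sigma ({..M} \<times> {..M}) K"
    then obtain j m k where z: "z = ((j, m), k)" and le: "j \<le> M" "m \<le> M" "k \<le> j" "k \<le> m"
      "j + m \<le> M + k"
      by (auto simp: K_def)
    have "M - (m - k + k + (j - k)) = M + k - (j + m)" using le by linarith
    moreover have "t ^ M = t ^ (M + k - (j + m)) * t ^ (m - k + k + (j - k))"
      unfolding power_add[symmetric] using le by (intro arg_cong[where f = "power t"]) linarith
    ultimately show "(\<lambda>(n, k, p). t ^ (M - (n + k + p)) / ?Q (M - (n + k + p))
        * triple_term l \<alpha> \<beta> x y t (n, k, p)) ((\<lambda>((j, m), k). (m - k, k, j - k)) z) = f z"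
      using le by (simp add: z f_def triple_term_def mult_ac)
  qed (auto simp: K_def)
  finally show ?thesis .
qed

section \<open>Rearrangement of the absolutely convergent fourfold sum\<close>

theorem theorem6p2:
  fixes q l x y t :: complex and \<alpha> \<beta> :: real
  fixes S :: "nat \<Rightarrow> nat \<Rightarrow> complex"
  assumes q: "0 < norm q" "norm q < 1" and l: "exp l = q"
    and \<alpha>: "\<alpha> > -1" and \<beta>: "\<beta> > -1"
    and t: "norm t < 1"
  defines "S \<equiv> (\<lambda>n k.
      qpower l (real (n + k) ^ 2 + real (n + k) * \<beta> + real k * (real k + \<alpha>))
        * (x * y * t) ^ k * (- y * t) ^ n
        / (qpoch q q k * qpoch q q n * qpoch (qpower l (\<alpha> + 1)) q k
             * qpoch (qpower l (\<beta> + 1)) q (n + k))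
        * phi01 (qpower l (\<alpha> + real k + 1)) q
            (- x * t * qpower l (\<alpha> + 2 * real k + real n + 1)))"
  shows "summable (\<lambda>n. qlaguerre l \<alpha> n x * qlaguerre l \<beta> n y / qpoch q q n * t ^ n)
    \<and> (\<forall>n. summable (\<lambda>k. S n k))
    \<and> summable (\<lambda>n. \<Sum>k. S n k)
    \<and> (\<Sum>n. qlaguerre l \<alpha> n x * qlaguerre l \<beta> n y / qpoch q q n * t ^ n)
        = 1 / qpoch_inf t q * (\<Sum>n. \<Sum>k. S n k)"
proof -
  have nq: "norm (exp l) < 1" using q l by simp
  then have l': "Re l < 0" by simp
  let ?T = "triple_term l \<alpha> \<beta> x y t"
  have abs: "(\<lambda>z. norm (?T z)) summable_on UNIV"
    by (rule triple_term_abs_summable[OF l' \<alpha> \<beta> t])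
  then have summ: "?T summable_on UNIV \<times> UNIV"
    using abs_summable_summable by auto
  have summ_n: "(\<lambda>z. ?T (n, z)) summable_on UNIV \<times> UNIV" for n
    using summable_on_SigmaD1[of "\<lambda>n z. ?T (n, z)" UNIV "\<lambda>_. UNIV" n] summ by simp
  have summ_nk: "(\<lambda>p. ?T (n, k, p)) summable_on UNIV" for n k
    using summable_on_SigmaD1[of "\<lambda>k p. ?T (n, k, p)" UNIV "\<lambda>_. UNIV" k] summ_n[of n]
    by (simp add: case_prod_unfold)
  define V where "V = infsum ?T UNIV"
  have S: "((\<lambda>p. ?T (n, k, p)) has_sum S n k) UNIV" for n k
  proof -
    define c where "c = qpower l (real (n + k) ^ 2 + real (n + k) * \<beta> + real k * (real k + \<alpha>))
        * (x * y * t) ^ k * (- y * t) ^ n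
        / (qpoch q q k * qpoch q q n * qpoch (qpower l (\<alpha> + 1)) q k
             * qpoch (qpower l (\<beta> + 1)) q (n + k))"
    define u where "u = (\<lambda>p. q ^ (p * (p - 1))
        * (- x * t * qpower l (\<alpha> + 2 * real k + real n + 1)) ^ p /
         (qpoch (qpower l (\<alpha> + real k + 1)) q p * qpoch q q p))"
    have T: "?T (n, k, p) = c * u p" for p
      unfolding c_def u_def by (rule triple_term_eq[OF l])
    have Seq: "S n k = c * suminf u"
      unfolding S_def c_def u_def phi01_def by (rule refl)
    have hs: "((\<lambda>p. c * u p) has_sum infsum (\<lambda>p. c * u p) UNIV) UNIV"
      using has_sum_infsum[OF summ_nk[of n k]] by (simp add: T)
    \<comment> \<open>Convergence of the \<open>phi01\<close> series comes from that of
      \<open>c * u\<close> by cancelling \<open>c\<close>. If \<open>c = 0\<close>, both sides are 0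
      whatever \<open>suminf u\<close> is.\<close>
    show ?thesis
    proof (cases "c = 0")
      case False
      have sums: "(\<lambda>p. c * u p) sums infsum (\<lambda>p. c * u p) UNIV"
        using hs by (rule has_sum_imp_sums)
      then have "summable u" using False by (auto simp: sums_iff)
      then have "infsum (\<lambda>p. c * u p) UNIV = S n k"
        using sums by (simp add: Seq sums_iff suminf_mult)
      then show ?thesis using hs by (simp add: T)
    qed (simp add: T Seq)
  qed
  have Sk: "((\<lambda>k. S n k) has_sum infsum (\<lambda>z. ?T (n, z)) UNIV) UNIV" for n
    using has_sum_SigmaD[where f = "\<lambda>z. ?T (n, z)" and A = UNIV and B = "\<lambda>_. UNIV" and g = "S n"] has_sum_infsum[OF summ_n[of n]] S
    by simp
  then have Ssums: "(\<lambda>k. S n k) sums infsum (\<lambda>z. ?T (n, z)) UNIV" for n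
    by (rule has_sum_imp_sums)
  have inner: "((\<lambda>z. ?T (n, z)) has_sum (\<Sum>k. S n k)) UNIV" for n
    using has_sum_infsum[OF summ_n[of n]] sums_unique[OF Ssums[of n]] by simp
  have "((\<lambda>n. \<Sum>k. S n k) has_sum V) UNIV"
    using has_sum_SigmaD[where f = ?T and A = UNIV and B = "\<lambda>_. UNIV"]
      has_sum_infsum[OF summ] inner
    by (simp add: V_def)
  then have V: "(\<lambda>n. \<Sum>k. S n k) sums V" by (rule has_sum_imp_sums)

  let ?e = "\<lambda>N. t ^ N / qpoch q q N"
  have nq': "norm q < 1" using q by simp
  have e: "(?e has_sum 1 / qpoch_inf t q) UNIV"
    by (rule norm_summable_imp_has_sum[OF abs_summable_euler[OF nq' t] euler_sums[OF nq' t]])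
  have e': "(\<lambda>N. norm (?e N)) summable_on UNIV"
    by (rule norm_summable_imp_summable_on) (use abs_summable_euler[OF nq' t] in simp)
  have prod: "((\<lambda>(N, z). ?e N * ?T z) has_sum 1 / qpoch_inf t q * V) (UNIV \<times> UNIV)"
    using has_sum_Times[OF e' e abs] has_sum_infsum[OF summ] by (simp add: V_def)
  define D where "D = (\<lambda>M. {(n, k, p). n + k + p \<le> (M :: nat)})"
  have finD: "finite (D M)" for M
    by (rule finite_subset[of _ "{..M} \<times> {..M} \<times> {..M}"]) (auto simp: D_def)
  \<comment> \<open>This shear replaces the Euler index N by the total degree M = N + n + k + p in
    t.\<close>
  have "bij_betw (\<lambda>(M, (n, k, p)). (M - (n + k + p), (n, k, p))) (Sigma UNIV D) (UNIV \<times> UNIV)"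
    by (rule bij_betw_byWitness[where f' = "\<lambda>(N, (n, k, p)). (N + (n + k + p), (n, k, p))"])
      (auto simp: D_def)
  from has_sum_reindex_bij_betw[OF this, of "\<lambda>(N, z). ?e N * ?T z"] prod
  have "((\<lambda>(M, (n, k, p)). ?e (M - (n + k + p)) * ?T (n, k, p)) has_sum 1 / qpoch_inf t q * V)
      (Sigma UNIV D)"
    by (simp add: case_prod_unfold)
  \<comment> \<open>Each fibre \<open>D M\<close> is finite, so its sum is exactly the one evaluated
    by \<open>qlaguerre_mult\<close>.\<close>
  then have "((\<lambda>M. \<Sum>(n, k, p)\<in>D M. ?e (M - (n + k + p)) * ?T (n, k, p))
      has_sum 1 / qpoch_inf t q * V) UNIV"
    by (rule has_sum_SigmaD) (simp add: case_prod_unfold has_sum_finite[OF finD])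
  then have "(\<lambda>M. qlaguerre l \<alpha> M x * qlaguerre l \<beta> M y / qpoch q q M * t ^ M)
      sums (1 / qpoch_inf t q * V)"
    using qlaguerre_mult[OF nq] by (intro has_sum_imp_sums) (simp add: D_def l)
  then show ?thesis
    using V Ssums by (auto simp: sums_iff)
qed

end
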